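(* Let $\pi$ be a convex polygon with $n$ vertices and let $k$ be an integer such that $n/2-2<k\leq n-5$. Then there exists a triangulation $T$ of $\pi$ such that the largest number of interior edges of $T$ incident to a vertex of $\pi$ is exactly $n-3-k$, and the eccentricity of $T$ in the flip-graph of $\pi$ is at most $n-4+k$.
   Context: Let $\pi$ be a convex polygon with $n$ vertices. An edge on $\pi$ is a set of exactly two vertices of $\pi$; two such edges cross when the relative interiors of the corresponding line segments intersect and the edges are distinct. A triangulation of $\pi$ is an inclusion-maximal set of pairwise non-crossing edges on $\pi$; it contains all sides of $\pi$ (boundary edges), and its remaining edges are its interior edges. A flip removes one interior edge from a triangulation and replaces it by the only other edge such that the result is again a triangulation of $\pi$. The flip-graph of $\pi$ has the triangulations of $\pi$ as vertices, two being adjacent when they differ by a flip. The eccentricity of a vertex of a graph is the largest possible distance in the graph from it to any vertex. *)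

theory Defs
  imports "HOL-Analysis.Analysis" "Graph_Theory.Shortest_Path"
begin

text \<open>A polygon is the closed two-dimensional region. Its vertices are the extreme points, so no
  three of them are collinear.\<close>

definition convex_polygon :: "(real^2) set \<Rightarrow> bool" where
  "convex_polygon P \<longleftrightarrow> polytope P \<and> aff_dim P = 2"

definition polygon_vertices :: "(real^2) set \<Rightarrow> (real^2) set" where
  "polygon_vertices P = {v. v extreme_point_of P}"

definition edges_on :: "(real^2) set \<Rightarrow> (real^2) set set" where
  "edges_on P = {e. e \<subseteq> polygon_vertices P \<and> card e = 2}"

definition crosses :: "(real^2) set \<Rightarrow> (real^2) set \<Rightarrow> bool" where
  "crosses e f \<longleftrightarrow>
     e \<noteq> f \<and> rel_interior (convex hull e) \<inter> rel_interior (convex hull f) \<noteq> {}"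

definition noncrossing :: "(real^2) set \<Rightarrow> (real^2) set set \<Rightarrow> bool" where
  "noncrossing P T \<longleftrightarrow> T \<subseteq> edges_on P \<and> (\<forall>e\<in>T. \<forall>f\<in>T. \<not> crosses e f)"

definition polygon_triangulation :: "(real^2) set \<Rightarrow> (real^2) set set \<Rightarrow> bool" where
  "polygon_triangulation P T \<longleftrightarrow>
     noncrossing P T \<and> (\<forall>T'. noncrossing P T' \<and> T \<subseteq> T' \<longrightarrow> T' = T)"

definition boundary_edges :: "(real^2) set \<Rightarrow> (real^2) set set" where
  "boundary_edges P = {e \<in> edges_on P. (convex hull e) edge_of P}"

definition interior_edges :: "(real^2) set \<Rightarrow> (real^2) set set \<Rightarrow> (real^2) set set" where
  "interior_edges P T = T - boundary_edges P"

definition flip :: "(real^2) set \<Rightarrow> (real^2) set set \<Rightarrow> (real^2) set set \<Rightarrow> bool" where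
  "flip P T T' \<longleftrightarrow> polygon_triangulation P T \<and> polygon_triangulation P T' \<and>
     (\<exists>e\<in>interior_edges P T. \<exists>f. f \<noteq> e \<and> T' = insert f (T - {e}))"

text \<open>Following the convention of \<^theory>\<open>Graph_Theory.Digraph\<close>, the undirected
  flip-graph is the symmetric digraph with an arc in each direction for every flip.\<close>

definition flip_graph ::
  "(real^2) set \<Rightarrow> ((real^2) set set, (real^2) set set \<times> (real^2) set set) pre_digraph" where
  "flip_graph P = \<lparr> verts = {T. polygon_triangulation P T}, arcs = {(T, T'). flip P T T'},
                    tail = fst, head = snd \<rparr>"

text \<open>With unit weights, \<^const>\<open>wf_digraph.\<mu>\<close> is the ordinary graph distance (the least number of
  arcs of a walk, infinite if there is none).\<close>

definition graph_dist :: "('a, 'b) pre_digraph \<Rightarrow> 'a \<Rightarrow> 'a \<Rightarrow> ereal" where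
  "graph_dist G u v = wf_digraph.\<mu> G (\<lambda>_. 1) u v"

definition eccentricity :: "('a, 'b) pre_digraph \<Rightarrow> 'a \<Rightarrow> ereal" where
  "eccentricity G u = (SUP v\<in>verts G. graph_dist G u v)"

definition interior_degree :: "(real^2) set \<Rightarrow> (real^2) set set \<Rightarrow> real^2 \<Rightarrow> nat" where
  "interior_degree P T v = card {e \<in> interior_edges P T. v \<in> e}"

definition max_interior_degree :: "(real^2) set \<Rightarrow> (real^2) set set \<Rightarrow> nat" where
  "max_interior_degree P T = Max (interior_degree P T ` polygon_vertices P)"

lemma boundary_edge_not_crosses:
  assumes e: "e \<in> boundary_edges P" and f: "f \<in> edges_on P"
  shows "\<not> crosses e f"
proof
  assume c: "crosses e f"
  have ce: "card e = 2" and face: "(convex hull e) face_of P"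
    using e by (auto simp: boundary_edges_def edges_on_def edge_of_def)
  have cf: "card f = 2" and fv: "f \<subseteq> polygon_vertices P"
    using f by (auto simp: edges_on_def)
  obtain a b where ab: "f = {a, b}" "a \<noteq> b" using cf by (auto simp: card_2_iff)
  have fP: "f \<subseteq> P" using fv by (auto simp: polygon_vertices_def extreme_point_of_def)
  obtain x where x: "x \<in> rel_interior (convex hull e)" "x \<in> rel_interior (convex hull f)"
    using c by (auto simp: crosses_def)
  have "x \<in> open_segment a b"
    using x(2) ab by (simp add: segment_convex_hull [symmetric] rel_interior_closed_segment)
  moreover have "x \<in> convex hull e" using x(1) rel_interior_subset by blast
  ultimately have "a \<in> convex hull e \<and> b \<in> convex hull e"
    using face fP ab unfolding face_of_def by auto
  moreover have "convex hull e \<subseteq> P" using face face_of_imp_subset by blast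
  ultimately have "a extreme_point_of (convex hull e)" "b extreme_point_of (convex hull e)"
    using fv ab unfolding polygon_vertices_def extreme_point_of_def by blast+
  then have "f \<subseteq> e" using ab extreme_point_of_convex_hull by blast
  then have "f = e" using ce cf by (metis card_subset_eq card.infinite zero_neq_numeral)
  then show False using c by (auto simp: crosses_def)
qed

lemma boundary_edges_subset_triangulation:
  assumes "polygon_triangulation P T" shows "boundary_edges P \<subseteq> T"
proof -
  have *: "\<not> crosses f e" if "\<not> crosses e f" for e f
    using that by (auto simp: crosses_def)
  have "boundary_edges P \<subseteq> edges_on P" by (auto simp: boundary_edges_def)
  then have "noncrossing P (T \<union> boundary_edges P)"
    using assms boundary_edge_not_crosses *
    unfolding polygon_triangulation_def noncrossing_def by (metis Un_iff Un_subset_iff subsetD)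
  then show ?thesis using assms unfolding polygon_triangulation_def by blast
qed

lemma flip_sym:
  assumes "flip P T T'" shows "flip P T' T"
proof -
  obtain e f where ef: "e \<in> T" "e \<notin> boundary_edges P" "f \<noteq> e" "T' = insert f (T - {e})"
    and T: "polygon_triangulation P T" "polygon_triangulation P T'"
    using assms by (auto simp: flip_def interior_edges_def)
  have "f \<notin> T"
  proof
    assume "f \<in> T"
    then have "T' \<subseteq> T" "T' \<noteq> T" using ef by auto
    then show False using T unfolding polygon_triangulation_def by blast
  qed
  then have "f \<in> interior_edges P T'" "T = insert e (T' - {f})"
    using ef boundary_edges_subset_triangulation [OF T(1)] by (auto simp: interior_edges_def)
  then show ?thesis using T ef(3) unfolding flip_def by metis
qed

lemma sym_digraph_flip_graph: "sym_digraph (flip_graph P)"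
proof (unfold_locales)
  show "symmetric (flip_graph P)"
    by (auto simp: symmetric_def sym_def arcs_ends_def arc_to_ends_def flip_graph_def image_iff
        intro: flip_sym)
qed (auto simp: flip_graph_def flip_def)

end

theory Submission
  imports Defs
begin

text \<open>If a triangle of a triangulation \<open>S\<close> has a vertex \<open>v\<close> and its side opposite to \<open>v\<close> is an interior
edge, then flipping that edge raises the interior degree of \<open>v\<close> by one. Repeating this, \<open>S\<close>
becomes the fan at \<open>v\<close>, in which all \<open>n - 3\<close> interior edges
are incident to \<open>v\<close>, after at most \<open>n - 3 - deg S v\<close> flips. Since flips are reversible, two
triangulations \<open>T\<close> and \<open>S\<close> are at distance at most \<open>2 (n - 3) - deg T v - deg S v\<close> for every
vertex \<open>v\<close> (\<open>graph_dist_le_via_origin_fan\<close>).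

Let \<open>d = n - 3 - k\<close>, so that \<open>n - 4 + k = 2 (n - 3) - d - 1\<close>. It suffices that \<open>T\<close> has two vertices
of degree \<open>d\<close> that are adjacent on the boundary, and no vertex of larger degree: two consecutive
vertices cannot both be ears of \<open>S\<close> (\<open>interior_degree_next_pos\<close>), so one of them has degree at
least one in \<open>S\<close>, and it serves as \<open>v\<close>. Such a \<open>T\<close> consists of two fans of \<open>d\<close> edges that share the
apex of the triangle on the side joining their centres. These fans occupy \<open>2 d + 3\<close> vertices,
which is exactly what \<open>k > n/2 - 2\<close> allows; the other vertices are joined by a zigzag, in which
degrees do not exceed \<open>2\<close>, and \<open>2 \<le> d\<close> is the hypothesis \<open>k \<le> n - 5\<close>.

The arguments about triangulations are made for pairs of indices below \<open>n\<close>, with interleaving in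
place of crossing. The link with the plane is a labelling of the vertices in which all increasing
triples turn counterclockwise: sort the vertices by angle around one of them
(\<open>ccw_labelling_exists\<close>). Crossings and sides can then be read off from the labels
(\<open>crosses_iff\<close>, \<open>boundary_iff\<close>).\<close>

section \<open>Maximal families of non-interleaved pairs\<close>

text \<open>Two chords of a convex polygon whose vertices are numbered in cyclic order cross exactly when their
index pairs interleave.\<close>
definition interleaved :: "nat \<Rightarrow> nat \<Rightarrow> nat \<Rightarrow> nat \<Rightarrow> bool" where
  "interleaved i j k l \<longleftrightarrow> i < k \<and> k < j \<and> j < l \<or> k < i \<and> i < l \<and> l < j"

text \<open>The predicate \<open>E\<close> stands for the set of the pairs \<open>i < j < n\<close> that satisfy it. The equivalence
says in one formula that the pairs are mutually non-interleaved (left to right) and that no pair can be added (right to left).\<close>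
definition maximal_nested :: "nat \<Rightarrow> (nat \<Rightarrow> nat \<Rightarrow> bool) \<Rightarrow> bool" where
  "maximal_nested n E \<longleftrightarrow>
     (\<forall>i j. i < j \<and> j < n \<longrightarrow>
        (E i j \<longleftrightarrow> (\<forall>k l. k < l \<and> l < n \<and> E k l \<longrightarrow> \<not> interleaved i j k l)))"

lemma maximal_nested_memI:
  assumes "maximal_nested n E" "i < j" "j < n"
    and "\<And>k l. k < l \<Longrightarrow> l < n \<Longrightarrow> E k l \<Longrightarrow> interleaved i j k l \<Longrightarrow> False"
  shows "E i j"
  using assms unfolding maximal_nested_def by blast

lemma maximal_nested_not_interleaved:
  assumes "maximal_nested n E" "i < j" "j < n" "E i j" "k < l" "l < n" "E k l"
  shows "\<not> interleaved i j k l"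
  using assms unfolding maximal_nested_def by blast

lemma maximal_nested_cong:
  assumes "\<And>i j. i < j \<Longrightarrow> j < n \<Longrightarrow> E i j \<longleftrightarrow> F i j"
  shows "maximal_nested n E \<longleftrightarrow> maximal_nested n F"
proof -
  have "maximal_nested n F" if "maximal_nested n E" "\<And>i j. i < j \<Longrightarrow> j < n \<Longrightarrow> E i j \<longleftrightarrow> F i j" for E F
    unfolding maximal_nested_def
    using maximal_nested_memI [OF that(1)] maximal_nested_not_interleaved [OF that(1)] that(2)
    by (intro allI impI iffI) blast+
  from this [of E F] this [of F E] show ?thesis using assms by blast
qed

lemma maximal_nested_side:
  assumes "maximal_nested n E" "Suc i < n"
  shows "E i (Suc i)"
  using assms by (auto intro!: maximal_nested_memI [OF assms(1)] simp: interleaved_def)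

lemma maximal_nested_long_side:
  assumes "maximal_nested n E" "1 < n"
  shows "E 0 (n - 1)"
  using assms by (auto intro!: maximal_nested_memI [OF assms(1)] simp: interleaved_def)

text \<open>A pair interleaving \<open>(a, b)\<close> has one index strictly between \<open>a\<close> and \<open>b\<close> and the other outside. The
outer index cannot be \<open>0\<close>, because \<open>0\<close> has no neighbour in the gap, and otherwise the pair
interleaves \<open>(0, a)\<close> or \<open>(0, b)\<close>.\<close>
lemma maximal_nested_gap_chord:
  assumes E: "maximal_nested n E" and "0 < a" "a < b" "b < n" "E 0 a" "E 0 b"
    and gap: "\<And>i. a < i \<Longrightarrow> i < b \<Longrightarrow> \<not> E 0 i"
  shows "E a b"
proof (rule maximal_nested_memI [OF E \<open>a < b\<close> \<open>b < n\<close>])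
  fix k l assume kl: "k < l" "l < n" "E k l" "interleaved a b k l"
  have "\<not> interleaved 0 a k l" "\<not> interleaved 0 b k l"
    using maximal_nested_not_interleaved [OF E] assms kl by auto
  moreover have "k = 0 \<Longrightarrow> \<not> (a < l \<and> l < b)" using gap kl by auto
  ultimately show False using kl assms(2-4) unfolding interleaved_def by auto
qed

text \<open>The apex of the triangle below the chord \<open>(a, b)\<close>: the last neighbour \<open>c < b\<close> of \<open>a\<close>. Anything
interleaving \<open>(c, b)\<close> would interleave \<open>(a, b)\<close> or \<open>(a, c)\<close>, or join \<open>a\<close> to an index beyond \<open>c\<close>.\<close>
lemma maximal_nested_apex:
  assumes E: "maximal_nested n E" and "Suc a < b" "b < n" "E a b"
  obtains c where "a < c" "c < b" "E a c" "E c b"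
proof -
  define C where "C = {c. a < c \<and> c < b \<and> E a c}"
  define c where "c = Max C"
  have fin: "finite C" unfolding C_def by auto
  have "Suc a \<in> C" using maximal_nested_side [OF E] assms by (auto simp: C_def)
  then have "c \<in> C" unfolding c_def using Max_in [OF fin] by auto
  then have c: "a < c" "c < b" "E a c" by (auto simp: C_def)
  have last: "\<not> E a i" if "c < i" "i < b" for i
  proof
    assume "E a i"
    then have "i \<in> C" using that c by (auto simp: C_def)
    then show False using that Max_ge [OF fin] c_def by fastforce
  qed
  have "E c b"
  proof (rule maximal_nested_memI [OF E \<open>c < b\<close> \<open>b < n\<close>])
    fix k l assume kl: "k < l" "l < n" "E k l" "interleaved c b k l"
    have "\<not> interleaved a b k l" "\<not> interleaved a c k l"
      using maximal_nested_not_interleaved [OF E] assms c kl by auto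
    moreover have "k = a \<Longrightarrow> \<not> (c < l \<and> l < b)" using last kl by auto
    ultimately show False using kl c unfolding interleaved_def by auto
  qed
  then show thesis using that c by blast
qed

lemma maximal_nested_enclosing_gap:
  assumes E: "maximal_nested n E" and j: "0 < j" "j < n" "\<not> E 0 j"
  obtains a b where "0 < a" "a < j" "j < b" "b < n" "E 0 a" "E 0 b"
    "\<And>i. a < i \<Longrightarrow> i < b \<Longrightarrow> \<not> E 0 i"
proof -
  define A where "A = {i. 0 < i \<and> i < j \<and> E 0 i}"
  define B where "B = {i. j < i \<and> i < n \<and> E 0 i}"
  have fin: "finite A" "finite B" unfolding A_def B_def by auto
  have "E 0 1" "E 0 (n - 1)"
    using maximal_nested_side [OF E, of 0] maximal_nested_long_side [OF E] j by auto
  then have "j \<noteq> 1" "j \<noteq> n - 1" using j by metis+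
  then have "1 \<in> A" "n - 1 \<in> B" using \<open>E 0 1\<close> \<open>E 0 (n - 1)\<close> j unfolding A_def B_def by auto
  then have "Max A \<in> A" "Min B \<in> B" using fin by (metis Max_in Min_in empty_iff)+
  moreover have "\<not> E 0 i" if "Max A < i" "i < Min B" for i
  proof
    assume "E 0 i"
    have "i < n" "0 < i" using that \<open>Min B \<in> B\<close> by (auto simp: B_def)
    moreover have "i \<noteq> j" using \<open>E 0 i\<close> j by auto
    ultimately have "i \<in> A \<or> i \<in> B" using \<open>E 0 i\<close> unfolding A_def B_def by auto
    then show False using that Max_ge [OF fin(1)] Min_le [OF fin(2)] by fastforce
  qed
  ultimately show thesis using that [of "Max A" "Min B"] unfolding A_def B_def by blast
qed

text \<open>The flip inside the quadrilateral \<open>0, a, c, b\<close>. Its four sides are present, and a pair that interleaves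
one of the two diagonals but none of the sides must be the other diagonal. So \<open>(a, b)\<close> is the only
pair in the way of \<open>(0, c)\<close>, and once it is replaced, the only pair that its removal could have made
room for is \<open>(0, c)\<close> itself.\<close>
lemma maximal_nested_flip:
  assumes E: "maximal_nested n E" and abc: "0 < a" "a < c" "c < b" "b < n"
    and "E 0 a" "E 0 b" "E a b" "E a c" "E c b"
  shows "maximal_nested n (\<lambda>i j. i = 0 \<and> j = c \<or> E i j \<and> \<not> (i = a \<and> j = b))"
    (is "maximal_nested n ?F")
  unfolding maximal_nested_def
proof (intro allI impI iffI)
  note not_il = maximal_nested_not_interleaved [OF E]
  have only: "k = a \<and> l = b" if "k < l" "l < n" "E k l" "interleaved 0 c k l" for k l
    using not_il [of 0 a k l] not_il [of 0 b k l] not_il [of a c k l] not_il [of c b k l]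
      that assms unfolding interleaved_def by auto
  fix i j k l assume "i < j \<and> j < n" "?F i j" "k < l \<and> l < n \<and> ?F k l"
  moreover have "interleaved i j k l \<longleftrightarrow> interleaved k l i j"
    unfolding interleaved_def by auto
  ultimately show "\<not> interleaved i j k l"
    using only [of k l] only [of i j] not_il [of i j k l] by (elim conjE disjE) (auto simp: interleaved_def)
next
  fix i j assume ij: "i < j \<and> j < n"
    and free: "\<forall>k l. k < l \<and> l < n \<and> ?F k l \<longrightarrow> \<not> interleaved i j k l"
  show "?F i j"
  proof (cases "interleaved i j a b")
    case True
    have "\<not> interleaved i j 0 a" "\<not> interleaved i j 0 b" "\<not> interleaved i j a c"
      "\<not> interleaved i j c b" using free assms by auto
    then show ?thesis using True ij abc unfolding interleaved_def by auto
  next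
    case False
    have "E i j"
    proof (rule maximal_nested_memI [OF E])
      fix k l assume "k < l" "l < n" "E k l" "interleaved i j k l"
      then show False using free False by blast
    qed (use ij in auto)
    moreover have "\<not> (i = a \<and> j = b)"
      using free [rule_format, of 0 c] abc by (auto simp: interleaved_def)
    ultimately show ?thesis by blast
  qed
qed

text \<open>A pair \<open>(i, j)\<close> with \<open>0 < i\<close> and \<open>i + 1 < j\<close> interleaves the spoke \<open>(0, i + 1)\<close>.\<close>
lemma maximal_nested_eq_fan:
  assumes E: "maximal_nested n E" and all: "\<And>j. 0 < j \<Longrightarrow> j < n \<Longrightarrow> E 0 j" and ij: "i < j" "j < n"
  shows "E i j \<longleftrightarrow> i = 0 \<or> j = Suc i"
proof
  assume "E i j"
  show "i = 0 \<or> j = Suc i"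
  proof (rule ccontr)
    assume "\<not> ?thesis"
    then have "interleaved i j 0 (Suc i)" using ij by (auto simp: interleaved_def)
    then show False
      using maximal_nested_not_interleaved [OF E ij \<open>E i j\<close>, of 0 "Suc i"] all ij by auto
  qed
next
  assume "i = 0 \<or> j = Suc i"
  then show "E i j" using all ij maximal_nested_side [OF E] by auto
qed

section \<open>Two adjacent fans completed by a zigzag\<close>

text \<open>In order, the disjuncts are: the sides of the polygon; the \<open>d\<close> spokes of the fan at \<open>1\<close>; the \<open>d\<close>
spokes of the fan at \<open>0\<close>; and a zigzag. Both fans contain the apex \<open>d + 2\<close> of the triangle on the
side \<open>(0, 1)\<close>. The zigzag triangulates the polygon on \<open>2 * d + 1, \<dots>, n - 1\<close> by the path
\<open>2 * d + 1, n - 1, 2 * d + 2, n - 2, \<dots>\<close>, whose steps have the two alternating index sums; it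
absorbs all remaining vertices while adding at most two to any degree.\<close>
definition double_fan :: "nat \<Rightarrow> nat \<Rightarrow> nat \<Rightarrow> nat \<Rightarrow> bool" where
  "double_fan n d i j \<longleftrightarrow>
     j = Suc i \<or> i = 0 \<and> j = n - 1 \<or>
     i = 1 \<and> 3 \<le> j \<and> j \<le> d + 2 \<or>
     i = 0 \<and> d + 2 \<le> j \<and> j \<le> 2 * d + 1 \<or>
     2 * d + 1 \<le> i \<and> (i + j = n + 2 * d \<or> i + j = n + 2 * d + 1)"

lemma double_fan_not_interleaved:
  assumes "1 \<le> d" "2 * d + 3 \<le> n" "i < j" "j < n" "k < l" "l < n"
    and "double_fan n d i j" "double_fan n d k l" "i < k" "k < j"
  shows "l \<le> j"
  using assms unfolding double_fan_def by auto

text \<open>For maximality, each missing pair \<open>(i, j)\<close> is matched with a pair of the family that interleaves it: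
the spokes to the common apex or the base of the zigzag if \<open>i \<le> 1\<close>, the spoke to \<open>i + 1\<close> if \<open>i\<close> lies
in the range of a fan, and otherwise the zigzag step that leaves \<open>i + 1\<close> or arrives at \<open>j - 1\<close>,
depending on the side of the zigzag on which the sum \<open>i + j\<close> falls.\<close>
lemma maximal_nested_double_fan:
  assumes d: "1 \<le> d" and n: "2 * d + 3 \<le> n"
  shows "maximal_nested n (double_fan n d)"
  unfolding maximal_nested_def
proof (intro allI impI iffI)
  fix i j k l assume "i < j \<and> j < n" "double_fan n d i j" "k < l \<and> l < n \<and> double_fan n d k l"
  then show "\<not> interleaved i j k l"
    using double_fan_not_interleaved [OF d n, of i j k l] double_fan_not_interleaved [OF d n, of k l i j]
    unfolding interleaved_def by auto
next
  fix i j assume ij: "i < j \<and> j < n"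
    and free: "\<forall>k l. k < l \<and> l < n \<and> double_fan n d k l \<longrightarrow> \<not> interleaved i j k l"
  show "double_fan n d i j"
  proof (rule ccontr)
    assume no: "\<not> ?thesis"
    have free': False if "k < l" "l < n" "double_fan n d k l" "interleaved i j k l" for k l
      using free that by blast
    have not_side: "j \<noteq> Suc i" and not_long: "\<not> (i = 0 \<and> j = n - 1)"
      and not_fan1: "\<not> (i = 1 \<and> 3 \<le> j \<and> j \<le> d + 2)"
      and not_fan0: "\<not> (i = 0 \<and> d + 2 \<le> j \<and> j \<le> 2 * d + 1)"
      and not_zigzag: "2 * d + 1 \<le> i \<Longrightarrow> i + j \<noteq> n + 2 * d \<and> i + j \<noteq> n + 2 * d + 1"
      using no unfolding double_fan_def by blast+
    consider "i = 0" "2 \<le> j" "j \<le> d + 1" | "i = 0" "2 * d + 2 \<le> j" "j \<le> n - 2" | "i = 1" "d + 3 \<le> j"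
      | "2 \<le> i" "i \<le> d + 1" "i + 2 \<le> j" | "d + 2 \<le> i" "i \<le> 2 * d" "i + 2 \<le> j"
      | "2 * d + 1 \<le> i" "i + 2 \<le> j" "i + j < n + 2 * d"
      | "2 * d + 1 \<le> i" "i + 2 \<le> j" "n + 2 * d + 1 < i + j"
    proof -
      consider "i = 0" | "i = 1" | "2 \<le> i" "i \<le> d + 1" | "d + 2 \<le> i" "i \<le> 2 * d" | "2 * d + 1 \<le> i"
        by linarith
      then show thesis
      proof cases
        case 1
        then have "j \<le> d + 1 \<or> 2 * d + 2 \<le> j" "2 \<le> j" "j \<le> n - 2"
          using ij not_side not_long not_fan0 by auto
        then show ?thesis using 1 that(1,2) by blast
      next
        case 2
        then have "d + 3 \<le> j" using ij not_side not_fan1 by auto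
        then show ?thesis using 2 that(3) by blast
      next
        case 3
        then show ?thesis using ij not_side that(4) by auto
      next
        case 4
        then show ?thesis using ij not_side that(5) by auto
      next
        case 5
        then have "i + j < n + 2 * d \<or> n + 2 * d + 1 < i + j" "i + 2 \<le> j"
          using ij not_side not_zigzag by auto
        then show ?thesis using 5 that(6,7) by blast
      qed
    qed
    then show False
    proof cases
      case 1 then show False
        by (intro free' [of 1 "d + 2"]) (use d n ij in \<open>auto simp: double_fan_def interleaved_def\<close>)
    next
      case 2 then show False
        by (intro free' [of "2 * d + 1" "n - 1"]) (use d n ij in \<open>auto simp: double_fan_def interleaved_def\<close>)
    next
      case 3 then show False
        by (intro free' [of 0 "d + 2"]) (use d n ij in \<open>auto simp: double_fan_def interleaved_def\<close>)
    next
      case 4 then show False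
        by (intro free' [of 1 "i + 1"]) (use d n ij in \<open>auto simp: double_fan_def interleaved_def\<close>)
    next
      case 5 then show False
        by (intro free' [of 0 "i + 1"]) (use d n ij in \<open>auto simp: double_fan_def interleaved_def\<close>)
    next
      case 6 then show False
        by (intro free' [of "i + 1" "n + 2 * d - i"]) (use d n ij in \<open>auto simp: double_fan_def interleaved_def\<close>)
    next
      case 7 then show False
        by (intro free' [of "n + 2 * d + 1 - j" "j - 1"]) (use d n ij in \<open>auto simp: double_fan_def interleaved_def\<close>)
    qed
  qed
qed



section \<open>Orientation of triples and crossing of segments\<close>

text \<open>Twice the signed area of the triangle \<open>a b c\<close>, positive when it is traversed counterclockwise.\<close>
definition orient :: "real^2 \<Rightarrow> real^2 \<Rightarrow> real^2 \<Rightarrow> real" where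
  "orient a b c = (b$1 - a$1) * (c$2 - a$2) - (b$2 - a$2) * (c$1 - a$1)"

lemma orient_rotate: "orient b c a = orient a b c"
  by (simp add: orient_def algebra_simps)

lemma orient_swap: "orient b a c = - orient a b c"
  by (simp add: orient_def algebra_simps)

lemma orient_ends [simp]: "orient a b a = 0" "orient a b b = 0"
  by (simp_all add: orient_def)

lemma orient_affine:
  "orient a b ((1 - u) *\<^sub>R x + u *\<^sub>R y) = (1 - u) * orient a b x + u * orient a b y"
  by (simp add: orient_def algebra_simps)

text \<open>Each segment has its ends strictly on opposite sides of the line through the other. As the orientation
against a fixed line is affine, its zero on each segment is given by the ratio of the values at the
ends, and the two zeros are the same point.\<close>
lemma open_segments_meet:
  assumes c: "orient a b c < 0" and d: "0 < orient a b d"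
    and a: "0 < orient c d a" and b: "orient c d b < 0"
  shows "open_segment a b \<inter> open_segment c d \<noteq> {}"
proof -
  define p q where "p = orient c d a" and "q = orient a b c"
  have den: "orient a b d = q + (p - orient c d b)"
    unfolding p_def q_def by (simp add: orient_def algebra_simps)
  define s where "s = p - orient c d b"
  have s: "0 < s" "p < s" "0 < p" "q < 0" "- q < s"
    using assms den unfolding s_def p_def q_def by linarith+
  define x where "x = (1 - p / s) *\<^sub>R a + (p / s) *\<^sub>R b"
  define y where "y = (1 - (- q) / s) *\<^sub>R c + (- q / s) *\<^sub>R d"
  have eq: "s *\<^sub>R x = s *\<^sub>R y"
  proof -
    have "s *\<^sub>R x = (s - p) *\<^sub>R a + p *\<^sub>R b" "s *\<^sub>R y = (s + q) *\<^sub>R c + (- q) *\<^sub>R d"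
      unfolding x_def y_def using s by (auto simp: scaleR_add_right algebra_simps)
    moreover have "(s - p) *\<^sub>R a + p *\<^sub>R b = (s + q) *\<^sub>R c + (- q) *\<^sub>R d"
      unfolding s_def p_def q_def
      by (simp add: vec_eq_iff forall_2 orient_def algebra_simps)
    ultimately show ?thesis by simp
  qed
  have "x = y" using eq s by simp
  have "a \<noteq> b" "c \<noteq> d" using assms by auto
  have "x \<in> open_segment a b"
    unfolding in_segment x_def using \<open>a \<noteq> b\<close> s by (auto intro!: exI [of _ "p / s"])
  moreover have "y \<in> open_segment c d"
    unfolding in_segment y_def using \<open>c \<noteq> d\<close> s
    by (intro conjI exI [of _ "- q / s"]) (auto simp: divide_simps)
  ultimately show ?thesis using \<open>x = y\<close> by blast
qed

text \<open>Along the open segment from \<open>c\<close> to \<open>d\<close> the orientation against \<open>a b\<close> is positive, on the line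
through \<open>a\<close> and \<open>b\<close> it vanishes.\<close>
lemma open_segments_disjoint:
  assumes "0 \<le> orient a b c" "0 \<le> orient a b d" "0 < orient a b c \<or> 0 < orient a b d"
  shows "open_segment a b \<inter> open_segment c d = {}"
proof -
  have False if "x \<in> open_segment a b" "x \<in> open_segment c d" for x
  proof -
    from that(1) obtain u where "x = (1 - u) *\<^sub>R a + u *\<^sub>R b"
      unfolding in_segment by blast
    then have "orient a b x = 0" by (simp add: orient_affine)
    moreover from that(2) obtain v where v: "0 < v" "v < 1" "x = (1 - v) *\<^sub>R c + v *\<^sub>R d"
      unfolding in_segment by blast
    then have "orient a b x = (1 - v) * orient a b c + v * orient a b d"
      by (simp add: orient_affine)
    moreover have "\<dots> > 0" using assms v
      by (auto intro: add_pos_nonneg add_nonneg_pos)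
    ultimately show False by simp
  qed
  then show ?thesis by blast
qed

lemma crosses_pairs:
  assumes "a \<noteq> b" "c \<noteq> d"
  shows "crosses {a, b} {c, d} \<longleftrightarrow> {a, b} \<noteq> {c, d} \<and> open_segment a b \<inter> open_segment c d \<noteq> {}"
  using assms unfolding crosses_def
  by (simp add: segment_convex_hull [symmetric] rel_interior_closed_segment)

section \<open>Counterclockwise labelling of the vertices\<close>

lemma polytope_eq_hull_vertices:
  assumes "polytope P"
  shows "P = convex hull (polygon_vertices P)" "finite (polygon_vertices P)"
proof -
  obtain S where S: "finite S" "P = convex hull S" using assms by (auto simp: polytope_def)
  show "P = convex hull (polygon_vertices P)"
    using Krein_Milman_polytope [OF S(1)] unfolding polygon_vertices_def S(2) .
  have "polygon_vertices P \<subseteq> S"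
    using extreme_point_of_convex_hull S(2) by (auto simp: polygon_vertices_def)
  then show "finite (polygon_vertices P)" using S(1) finite_subset by blast
qed

lemma vertex_notin_hull_other_vertices:
  assumes "polytope P" "v \<in> polygon_vertices P" "S \<subseteq> polygon_vertices P - {v}"
  shows "v \<notin> convex hull S"
proof
  assume "v \<in> convex hull S"
  have "S \<subseteq> P" using assms(3) by (auto simp: polygon_vertices_def extreme_point_of_def)
  then have "convex hull S \<subseteq> P" using assms(1) by (simp add: hull_minimal polytope_imp_convex)
  then have "v extreme_point_of convex hull S"
    using assms(2) \<open>v \<in> convex hull S\<close> by (auto simp: polygon_vertices_def extreme_point_of_def)
  then show False using extreme_point_of_convex_hull assms(3) by blast
qed

text \<open>Seen from one vertex, all the others lie in an open half-plane; so they can be sorted by angle.\<close>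
lemma vertices_support_functional:
  assumes "polytope P" "v \<in> polygon_vertices P"
  obtains w where "\<And>x. x \<in> polygon_vertices P \<Longrightarrow> x \<noteq> v \<Longrightarrow> 0 < w \<bullet> (x - v)"
proof -
  let ?H = "convex hull (polygon_vertices P - {v})"
  have "closed ?H"
    using polytope_eq_hull_vertices [OF assms(1)]
    by (intro compact_imp_closed finite_imp_compact_convex_hull) auto
  then obtain w b where wb: "w \<bullet> v < b" "\<And>x. x \<in> ?H \<Longrightarrow> b < w \<bullet> x"
    using separating_hyperplane_closed_point [of ?H v]
      vertex_notin_hull_other_vertices [OF assms order_refl] by auto
  show thesis
  proof
    fix x assume "x \<in> polygon_vertices P" "x \<noteq> v"
    then have "x \<in> ?H" by (simp add: hull_inc)
    then show "0 < w \<bullet> (x - v)" using wb by (force simp: inner_diff_right)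
  qed
qed

text \<open>In the frame formed by \<open>w\<close> and its quarter turn, \<open>slope z\<close> is the tangent of the angle at which \<open>z\<close> is
seen from \<open>a\<close>, and in an open half-plane a larger angle is the same as a positive orientation.\<close>
lemma orient_slopes:
  fixes a x y w :: "real^2"
  assumes "0 < w \<bullet> (x - a)" "0 < w \<bullet> (y - a)"
  defines "slope \<equiv> \<lambda>z. (w$1 * (z$2 - a$2) - w$2 * (z$1 - a$1)) / (w \<bullet> (z - a))"
  shows "slope x < slope y \<longleftrightarrow> 0 < orient a x y"
proof -
  define X Y where "X = x - a" and "Y = y - a"
  have pos: "0 < w \<bullet> X" "0 < w \<bullet> Y" using assms unfolding X_def Y_def by auto
  have inner: "w \<bullet> z = w$1 * z$1 + w$2 * z$2" for z :: "real^2"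
    by (simp add: inner_vec_def sum_2)
  have "(w$1 * Y$2 - w$2 * Y$1) * (w \<bullet> X) - (w$1 * X$2 - w$2 * X$1) * (w \<bullet> Y)
      = (w$1 ^ 2 + w$2 ^ 2) * orient a x y"
    unfolding inner orient_def X_def Y_def by (simp add: power2_eq_square algebra_simps)
  moreover have "0 < w$1 ^ 2 + w$2 ^ 2"
  proof -
    have "w$1 \<noteq> 0 \<or> w$2 \<noteq> 0" using pos(1) unfolding inner by auto
    then show ?thesis by (auto intro: add_pos_nonneg add_nonneg_pos)
  qed
  moreover have "slope x < slope y \<longleftrightarrow>
      (w$1 * X$2 - w$2 * X$1) * (w \<bullet> Y) < (w$1 * Y$2 - w$2 * Y$1) * (w \<bullet> X)"
    unfolding slope_def using pos by (simp add: X_def Y_def divide_simps mult.commute)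
  ultimately show ?thesis
    by (metis diff_gt_0_iff_gt zero_less_mult_pos mult_pos_pos)
qed

text \<open>Of three points on a line one lies between the other two, so it is not an extreme point.\<close>
lemma vertices_not_collinear:
  assumes "polytope P" "{a, b, c} \<subseteq> polygon_vertices P" "distinct [a, b, c]"
  shows "orient a b c \<noteq> 0"
proof
  assume 0: "orient a b c = 0"
  have "collinear {a, b, c}"
  proof -
    have "b \<noteq> a" using assms by auto
    define p q r s where pqrs: "p = b$1 - a$1" "q = b$2 - a$2" "r = c$1 - a$1" "s = c$2 - a$2"
    have eq: "p * s = q * r" using 0 by (simp add: orient_def pqrs)
    define N where "N = p * p + q * q"
    have "N \<noteq> 0"
      using \<open>b \<noteq> a\<close> unfolding N_def by (auto simp: sum_squares_eq_zero_iff pqrs vec_eq_iff forall_2)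
    have "N * r = (p * r + q * s) * p" "N * s = (p * r + q * s) * q"
      unfolding N_def using eq by algebra+
    then have "c - a = ((p * r + q * s) / N) *\<^sub>R (b - a)"
      using \<open>N \<noteq> 0\<close> by (simp add: vec_eq_iff forall_2 divide_simps mult.commute flip: pqrs)
    then obtain t where "c = a + t *\<^sub>R (b - a)" by (metis diff_add_cancel add.commute)
    moreover have "a = a + 0 *\<^sub>R (b - a)" "b = a + 1 *\<^sub>R (b - a)" by simp_all
    ultimately show ?thesis unfolding collinear_alt by blast
  qed
  then have "a \<in> closed_segment b c \<or> b \<in> closed_segment c a \<or> c \<in> closed_segment a b"
    unfolding collinear_between_cases between_mem_segment .
  then show False
    using vertex_notin_hull_other_vertices [OF assms(1), of a "{b, c}"]
      vertex_notin_hull_other_vertices [OF assms(1), of b "{c, a}"]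
      vertex_notin_hull_other_vertices [OF assms(1), of c "{a, b}"] assms(2,3)
    unfolding segment_convex_hull by auto
qed

text \<open>Sorting by angle around \<open>p\<close> orients only the triples through \<open>p\<close>. For the others, write
\<open>b - p = u (a - p) + v (c - p)\<close> with positive \<open>u, v\<close>; the sign of \<open>orient a b c\<close> is that of
\<open>u + v - 1\<close>, and \<open>u + v \<le> 1\<close> would put the vertex \<open>b\<close> into the triangle \<open>p a c\<close>.\<close>
lemma orient_pos_of_fan:
  assumes P: "polytope P" "{p, a, b, c} \<subseteq> polygon_vertices P" "distinct [p, a, b, c]"
    and ab: "0 < orient p a b" and bc: "0 < orient p b c" and ac: "0 < orient p a c"
  shows "0 < orient a b c"
proof (rule ccontr)
  assume neg: "\<not> ?thesis"
  define u v where "u = orient p b c / orient p a c" and "v = orient p a b / orient p a c"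
  have uv: "0 < u" "0 < v" using assms unfolding u_def v_def by auto
  have "orient a b c = orient p a b + orient p b c - orient p a c"
    by (simp add: orient_def algebra_simps)
  then have le: "u + v \<le> 1"
    using neg ac unfolding u_def v_def by (simp add: divide_simps)
  \<comment> \<open>Cramer's rule for the coordinates of \<open>b\<close>.\<close>
  have "orient p a c *\<^sub>R ((1 - u - v) *\<^sub>R p + u *\<^sub>R a + v *\<^sub>R c) =
      (orient p a c - orient p b c - orient p a b) *\<^sub>R p + orient p b c *\<^sub>R a + orient p a b *\<^sub>R c"
    unfolding u_def v_def using ac by (simp add: scaleR_add_right right_diff_distrib)
  also have "\<dots> = orient p a c *\<^sub>R b"
    by (simp add: vec_eq_iff forall_2 orient_def algebra_simps)
  finally have "(1 - u - v) *\<^sub>R p + u *\<^sub>R a + v *\<^sub>R c = b" using ac by simp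
  then have "b \<in> convex hull {p, a, c}"
    unfolding convex_hull_3 mem_Collect_eq using uv le
    by (intro exI [of _ "1 - u - v"] exI [of _ u] exI [of _ v]) auto
  then show False
    using vertex_notin_hull_other_vertices [OF P(1), of b "{p, a, c}"] P(2,3) by auto
qed

lemma sorted_enumeration:
  fixes g :: "'a \<Rightarrow> 'b :: linorder"
  assumes "finite V" "inj_on g V"
  obtains h where "bij_betw h {..<card V} V"
    "\<And>i j. i < j \<Longrightarrow> j < card V \<Longrightarrow> g (h i) < g (h j)"
proof
  define xs where "xs = sorted_list_of_set (g ` V)"
  have len: "length xs = card V" using assms by (simp add: xs_def card_image)
  have "bij_betw ((!) xs) {..<card V} (g ` V)"
    by (rule bij_betw_nth) (use len assms(1) in \<open>auto simp: xs_def\<close>)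
  from bij_betw_trans [OF this bij_betw_inv_into [OF inj_on_imp_bij_betw [OF assms(2)]]]
  show "bij_betw (inv_into V g \<circ> (!) xs) {..<card V} V" .
  fix i j assume "i < j" "j < card V"
  moreover have "set xs = g ` V" using assms by (simp add: xs_def)
  ultimately have "xs ! i \<in> g ` V" "xs ! j \<in> g ` V" "xs ! i < xs ! j"
    using len strict_sorted_list_of_set [of "g ` V"]
    by (auto simp: xs_def sorted_wrt_nth_less intro: nth_mem)
  then show "g ((inv_into V g \<circ> (!) xs) i) < g ((inv_into V g \<circ> (!) xs) j)"
    by (simp add: f_inv_into_f)
qed

text \<open>The condition on triples is a sign condition invariant under cyclic shifts of the labels, so that
statements about the vertex labelled \<open>0\<close> transfer to any other vertex.\<close>
locale ccw_labelling =
  fixes P :: "(real^2) set" and f :: "nat \<Rightarrow> real^2" and n :: nat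
  assumes polytope: "polytope P"
    and bij: "bij_betw f {..<n} (polygon_vertices P)"
    and three: "3 \<le> n"
    and ccw: "\<And>i j k. i < j \<Longrightarrow> j < k \<Longrightarrow> k < n \<Longrightarrow> 0 < orient (f i) (f j) (f k)"

lemma ccw_labelling_exists:
  assumes P: "polytope P" and n: "card (polygon_vertices P) = n" "3 \<le> n"
  obtains f where "ccw_labelling P f n"
proof -
  let ?V = "polygon_vertices P"
  have fin: "finite ?V" using polytope_eq_hull_vertices [OF P] by simp
  obtain a where a: "a \<in> ?V" using n by fastforce
  obtain w where w: "\<And>x. x \<in> ?V \<Longrightarrow> x \<noteq> a \<Longrightarrow> 0 < w \<bullet> (x - a)"
    using vertices_support_functional [OF P a] by blast
  define slope where "slope = (\<lambda>z. (w$1 * (z$2 - a$2) - w$2 * (z$1 - a$1)) / (w \<bullet> (z - a)))"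
  have slope_less: "slope x < slope y \<longleftrightarrow> 0 < orient a x y"
    if "x \<in> ?V - {a}" "y \<in> ?V - {a}" for x y
    unfolding slope_def using orient_slopes w that by blast
  have inj: "inj_on slope (?V - {a})"
  proof (rule inj_onI, rule ccontr)
    fix x y assume xy: "x \<in> ?V - {a}" "y \<in> ?V - {a}" "slope x = slope y" "x \<noteq> y"
    then have "\<not> 0 < orient a x y" "\<not> 0 < orient a y x"
      using slope_less [of x y] slope_less [of y x] by auto
    moreover have "orient a y x = - orient a x y" by (metis orient_rotate orient_swap)
    ultimately show False using vertices_not_collinear [OF P, of a x y] a xy by auto
  qed
  have card: "card (?V - {a}) = n - 1" using a n fin by simp
  obtain h where h: "bij_betw h {..<n - 1} (?V - {a})"
    and h_less: "\<And>i j. i < j \<Longrightarrow> j < n - 1 \<Longrightarrow> slope (h i) < slope (h j)"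
    using sorted_enumeration [OF _ inj] fin card by auto
  define f where "f i = (if i = 0 then a else h (i - 1))" for i
  have hV: "h i \<in> ?V - {a}" if "i < n - 1" for i using h that by (auto dest: bij_betwE)
  have f_bij: "bij_betw f {..<n} ?V"
  proof (rule bij_betw_imageI)
    show inj_f: "inj_on f {..<n}"
    proof (rule inj_onI)
      fix i j assume ij: "i \<in> {..<n}" "j \<in> {..<n}" "f i = f j"
      have "i \<noteq> 0 \<Longrightarrow> h (i - 1) \<noteq> a" "j \<noteq> 0 \<Longrightarrow> h (j - 1) \<noteq> a"
        using hV [of "i - 1"] hV [of "j - 1"] ij by auto
      moreover have "i - 1 = j - 1" if "i \<noteq> 0" "j \<noteq> 0"
        using ij that inj_onD [OF bij_betw_imp_inj_on [OF h], of "i - 1" "j - 1"]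
        by (auto simp: f_def)
      ultimately show "i = j" using ij by (auto simp: f_def split: if_splits)
    qed
    have "f ` {..<n} \<subseteq> ?V" using a hV by (auto simp: f_def)
    moreover have "card (f ` {..<n}) = card ?V" using n inj_f by (simp add: card_image)
    ultimately show "f ` {..<n} = ?V" using fin by (simp add: card_subset_eq)
  qed
  have fV: "f i \<in> ?V" if "i < n" for i using f_bij that by (auto dest: bij_betwE)
  have f_neq: "f i \<noteq> f j" if "i < n" "j < n" "i \<noteq> j" for i j
    using that f_bij by (auto simp: bij_betw_def inj_on_def)
  have fan: "0 < orient a (f j) (f k)" if "0 < j" "j < k" "k < n" for j k
    using slope_less h_less [of "j - 1" "k - 1"] hV that by (auto simp: f_def)
  have "0 < orient (f i) (f j) (f k)" if ijk: "i < j" "j < k" "k < n" for i j k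
  proof (cases "i = 0")
    case True
    then show ?thesis using fan ijk by (simp add: f_def)
  next
    case False
    have "a = f 0" by (simp add: f_def)
    then have "distinct [a, f i, f j, f k]" using f_neq ijk False by auto
    then show ?thesis
      using orient_pos_of_fan [OF P, of a "f i" "f j" "f k"] fan [of i j] fan [of j k] fan [of i k]
        fV a ijk False by auto
  qed
  then have "ccw_labelling P f n" using P f_bij n by unfold_locales auto
  then show thesis by (rule that)
qed

context ccw_labelling
begin

lemma rotated: "ccw_labelling P (\<lambda>i. f (Suc i mod n)) n"
proof
  have "bij_betw (\<lambda>i. Suc i mod n) {..<n} {..<n}"
  proof (rule bij_betw_imageI)
    show inj: "inj_on (\<lambda>i. Suc i mod n) {..<n}"
      by (auto simp: inj_on_def mod_Suc split: if_splits)
    have "(\<lambda>i. Suc i mod n) ` {..<n} \<subseteq> {..<n}" using three by auto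
    then show "(\<lambda>i. Suc i mod n) ` {..<n} = {..<n}"
      using inj by (simp add: card_image card_subset_eq)
  qed
  from bij_betw_trans [OF this bij]
  show "bij_betw (\<lambda>i. f (Suc i mod n)) {..<n} (polygon_vertices P)" by (simp add: o_def)
  fix i j k assume ijk: "i < j" "j < k" "k < n"
  show "0 < orient (f (Suc i mod n)) (f (Suc j mod n)) (f (Suc k mod n))"
  proof (cases "Suc k = n")
    case True
    then show ?thesis
      using ijk ccw [of 0 "Suc i" "Suc j"] orient_rotate [of "f (Suc i)" "f (Suc j)" "f 0"] by simp
  next
    case False
    then show ?thesis using ijk ccw [of "Suc i" "Suc j" "Suc k"] by simp
  qed
qed (use polytope three in auto)

section \<open>Crossings, sides and triangulations in terms of labels\<close>

lemma vertex: "i < n \<Longrightarrow> f i \<in> polygon_vertices P"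
  using bij by (auto dest: bij_betwE)

lemma label_eq_iff: "i < n \<Longrightarrow> j < n \<Longrightarrow> f i = f j \<longleftrightarrow> i = j"
  using bij by (auto simp: bij_betw_def inj_on_def)

lemma vertex_cases:
  assumes "v \<in> polygon_vertices P" obtains i where "i < n" "v = f i"
  using assms bij by (auto simp: bij_betw_def)

lemma pair_eq_iff:
  "i < j \<Longrightarrow> j < n \<Longrightarrow> k < l \<Longrightarrow> l < n \<Longrightarrow> {f i, f j} = {f k, f l} \<longleftrightarrow> i = k \<and> j = l"
  by (auto simp: doubleton_eq_iff label_eq_iff)

lemma edges_on_iff: "e \<in> edges_on P \<longleftrightarrow> (\<exists>i j. i < j \<and> j < n \<and> e = {f i, f j})"
proof
  assume "e \<in> edges_on P"
  then obtain x y where e: "e = {x, y}" "x \<noteq> y" "x \<in> polygon_vertices P" "y \<in> polygon_vertices P"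
    by (auto simp: edges_on_def card_2_iff)
  obtain i j where "i < n" "j < n" "x = f i" "y = f j"
    using vertex_cases [OF e(3)] vertex_cases [OF e(4)] by metis
  then show "\<exists>i j. i < j \<and> j < n \<and> e = {f i, f j}"
    using e(1,2) by (cases i j rule: linorder_cases) auto
qed (auto simp: edges_on_def vertex label_eq_iff)

lemma orient_inside: "i < k \<Longrightarrow> k < j \<Longrightarrow> j < n \<Longrightarrow> orient (f i) (f j) (f k) < 0"
  using ccw [of i k j] orient_swap [of "f j" "f i" "f k"] orient_rotate [of "f i" "f k" "f j"] by simp

lemma orient_outside: "i < j \<Longrightarrow> j < n \<Longrightarrow> k < n \<Longrightarrow> k < i \<or> j < k \<Longrightarrow> 0 < orient (f i) (f j) (f k)"
  using ccw [of i j k] ccw [of k i j] orient_rotate [of "f i" "f j" "f k"] by auto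

text \<open>The line through \<open>f i\<close> and \<open>f j\<close> separates the labels between \<open>i\<close> and \<open>j\<close> from the others. Pairs
that do not interleave \<open>(i, j)\<close> stay weakly on one side of it.\<close>
lemma crosses_iff:
  assumes ij: "i < j" "j < n" and kl: "k < l" "l < n"
  shows "crosses {f i, f j} {f k, f l} \<longleftrightarrow> interleaved i j k l"
proof -
  have neq: "f i \<noteq> f j" "f k \<noteq> f l" using assms by (auto simp: label_eq_iff)
  have meet: "open_segment (f i) (f j) \<inter> open_segment (f k) (f l) \<noteq> {}"
    if "i < k" "k < j" "j < l" "l < n" for i j k l
    using that by (intro open_segments_meet orient_inside orient_outside) auto
  show ?thesis
  proof
    assume "interleaved i j k l"
    then have "open_segment (f i) (f j) \<inter> open_segment (f k) (f l) \<noteq> {}"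
      using meet [of i k j l] meet [of k i l j] assms unfolding interleaved_def by blast
    moreover have "{f i, f j} \<noteq> {f k, f l}"
      using \<open>interleaved i j k l\<close> assms by (auto simp: pair_eq_iff interleaved_def)
    ultimately show "crosses {f i, f j} {f k, f l}" using neq by (simp add: crosses_pairs)
  next
    assume cr: "crosses {f i, f j} {f k, f l}"
    show "interleaved i j k l"
    proof (rule ccontr)
      assume no: "\<not> interleaved i j k l"
      have neq': "\<not> (i = k \<and> j = l)" using cr by (auto simp: crosses_def)
      have "open_segment (f i) (f j) \<inter> open_segment (f k) (f l) = {}"
      proof (cases "i \<le> k \<and> l \<le> j")
        case True
        have sgn: "m = i \<or> m = j \<or> 0 < orient (f j) (f i) (f m)" if "i \<le> m" "m \<le> j" for m
          using orient_inside [of i m j] orient_swap [of "f i" "f j" "f m"] that ij by linarith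
        have "open_segment (f j) (f i) \<inter> open_segment (f k) (f l) = {}"
          by (rule open_segments_disjoint) (use sgn [of k] sgn [of l] True kl neq' in auto)
        then show ?thesis by (simp add: open_segment_commute)
      next
        case False
        have sgn: "m = i \<or> m = j \<or> 0 < orient (f i) (f j) (f m)" if "m \<le> i \<or> j \<le> m" "m < n" for m
          using orient_outside [of i j m] that ij by force
        have "k \<le> i \<or> j \<le> k" "l \<le> i \<or> j \<le> l" using no False ij kl unfolding interleaved_def by auto
        then show ?thesis
          by (intro open_segments_disjoint) (use sgn [of k] sgn [of l] ij kl neq' in auto)
      qed
      then show False using cr neq by (simp add: crosses_pairs)
    qed
  qed
qed

text \<open>All the other vertices lie strictly on one side of the line through two cyclically consecutive ones.\<close>
lemma side_is_edge:
  assumes ij: "i < j" "j < n" and "j = Suc i \<or> i = 0 \<and> j = n - 1"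
  shows "{f i, f j} \<in> boundary_edges P"
proof -
  have same: "(\<forall>k. k < n \<and> k \<noteq> i \<and> k \<noteq> j \<longrightarrow> 0 < orient (f i) (f j) (f k)) \<or>
      (\<forall>k. k < n \<and> k \<noteq> i \<and> k \<noteq> j \<longrightarrow> 0 < orient (f j) (f i) (f k))"
    using assms(3)
  proof
    assume "j = Suc i"
    then have "k < i \<or> j < k" if "k \<noteq> i" "k \<noteq> j" for k using that by auto
    then show ?thesis using ij orient_outside by blast
  next
    assume *: "i = 0 \<and> j = n - 1"
    then have "orient (f i) (f j) (f k) < 0" if "k < n" "k \<noteq> i" "k \<noteq> j" for k
      using that by (intro orient_inside) auto
    then show ?thesis using orient_swap [of "f i" "f j"] by auto
  qed
  obtain a b where ab: "{a, b} = {f i, f j}" "a \<noteq> b"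
    and pos: "\<And>k. k < n \<Longrightarrow> f k \<notin> {a, b} \<Longrightarrow> 0 < orient a b (f k)"
  proof -
    have "f i \<noteq> f j" using ij by (simp add: label_eq_iff)
    then show thesis
      using same that [of "f i" "f j"] that [of "f j" "f i"] by (metis insert_iff insert_commute)
  qed
  have "affine hull {a, b} \<subseteq> {x. orient a b x = 0}"
  proof
    fix x assume "x \<in> affine hull {a, b}"
    then obtain u v where "x = u *\<^sub>R a + v *\<^sub>R b" "u + v = 1" by (auto simp: affine_hull_2)
    moreover from this have "u = 1 - v" by simp
    ultimately show "x \<in> {x. orient a b x = 0}" using orient_affine [of a b v a b] by simp
  qed
  moreover have "convex hull (polygon_vertices P - {a, b}) \<subseteq> {x. 0 < orient a b x}"
  proof (rule hull_minimal)
    show "polygon_vertices P - {a, b} \<subseteq> {x. 0 < orient a b x}"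
      using pos by (auto elim: vertex_cases)
    show "convex {x. 0 < orient a b x}"
    proof (unfold convex_alt, intro ballI allI impI, unfold mem_Collect_eq orient_affine)
      fix x y and u :: real
      assume "0 < orient a b x" "0 < orient a b y" "0 \<le> u \<and> u \<le> 1"
      then show "0 < (1 - u) * orient a b x + u * orient a b y"
        by (cases "u = 0") (auto intro: add_nonneg_pos)
    qed
  qed
  ultimately have "affine hull {a, b} \<inter> convex hull (polygon_vertices P - {a, b}) = {}" by force
  then have "(convex hull {a, b}) face_of (convex hull (polygon_vertices P))"
    using polytope_eq_hull_vertices [OF polytope] ab ij vertex
    by (intro face_of_convex_hulls) auto
  then have "(convex hull {f i, f j}) face_of P"
    using polytope_eq_hull_vertices(1) [OF polytope] ab by simp
  moreover have "f i \<noteq> f j" using ij by (simp add: label_eq_iff)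
  ultimately show ?thesis
    using ij by (auto simp: boundary_edges_def edges_on_iff edge_of_def aff_dim_2 aff_dim_convex_hull)
qed

text \<open>Conversely, a boundary edge crosses nothing, whereas a chord that is not a side is crossed by a chord
leaving from the next label.\<close>
lemma boundary_iff:
  assumes ij: "i < j" "j < n"
  shows "{f i, f j} \<in> boundary_edges P \<longleftrightarrow> j = Suc i \<or> i = 0 \<and> j = n - 1"
proof
  assume bd: "{f i, f j} \<in> boundary_edges P"
  show "j = Suc i \<or> i = 0 \<and> j = n - 1"
  proof (rule ccontr)
    assume no: "\<not> ?thesis"
    obtain k l where kl: "k < l" "l < n" "interleaved i j k l"
    proof (cases "j = n - 1")
      case True
      \<comment> \<open>Here \<open>Suc j\<close> is out of range, and the label before \<open>i\<close>, which is not \<open>0\<close>, lies outside.\<close>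
      then show thesis using no ij that [of "i - 1" "Suc i"] by (auto simp: interleaved_def)
    next
      case False
      then show thesis using no ij that [of "Suc i" "Suc j"] by (auto simp: interleaved_def)
    qed
    then have "crosses {f i, f j} {f k, f l}" using crosses_iff ij by blast
    then show False using boundary_edge_not_crosses [OF bd] kl by (auto simp: edges_on_iff)
  qed
qed (use side_is_edge ij in auto)

text \<open>This reduces everything about triangulations to the combinatorics of index pairs.\<close>
lemma triangulation_iff:
  "polygon_triangulation P T \<longleftrightarrow>
     T \<subseteq> edges_on P \<and> maximal_nested n (\<lambda>i j. {f i, f j} \<in> T)" (is "?L \<longleftrightarrow> _ \<and> ?M")
proof -
  have edge: "{f i, f j} \<in> edges_on P" if "i < j" "j < n" for i j
    using that by (auto simp: edges_on_iff)
  show ?thesis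
  proof
    assume L: ?L
    then have T: "T \<subseteq> edges_on P" and nc: "\<And>e g. e \<in> T \<Longrightarrow> g \<in> T \<Longrightarrow> \<not> crosses e g"
      and max: "\<And>T'. noncrossing P T' \<Longrightarrow> T \<subseteq> T' \<Longrightarrow> T' = T"
      unfolding polygon_triangulation_def noncrossing_def by blast+
    have "{f i, f j} \<in> T" if ij: "i < j" "j < n"
      and free: "\<And>k l. k < l \<Longrightarrow> l < n \<Longrightarrow> {f k, f l} \<in> T \<Longrightarrow> \<not> interleaved i j k l" for i j
    proof -
      have "\<not> crosses {f i, f j} g" if g: "g \<in> T" for g
      proof -
        obtain k l where "k < l" "l < n" "g = {f k, f l}" using g T edges_on_iff by blast
        then show ?thesis using free g ij crosses_iff by blast
      qed
      moreover have "\<not> crosses g g" "crosses g h \<longleftrightarrow> crosses h g" for g h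
        by (auto simp: crosses_def)
      ultimately have "noncrossing P (insert {f i, f j} T)"
        using nc T edge [OF ij] unfolding noncrossing_def by blast
      then show ?thesis using max by blast
    qed
    moreover have "\<not> interleaved i j k l"
      if "i < j" "j < n" "{f i, f j} \<in> T" "k < l" "l < n" "{f k, f l} \<in> T" for i j k l
      using nc crosses_iff that by blast
    ultimately have ?M unfolding maximal_nested_def by (intro allI impI iffI) blast+
    then show "T \<subseteq> edges_on P \<and> ?M" using T by blast
  next
    assume R: "T \<subseteq> edges_on P \<and> ?M"
    then have T: "T \<subseteq> edges_on P" and M: ?M by auto
    have "\<not> crosses e g" if eg: "e \<in> T" "g \<in> T" for e g
    proof -
      obtain i j k l where "i < j" "j < n" "e = {f i, f j}" "k < l" "l < n" "g = {f k, f l}"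
        using eg T edges_on_iff by (meson subsetD)
      then show ?thesis using eg crosses_iff maximal_nested_not_interleaved [OF M] by blast
    qed
    then have "noncrossing P T" using T unfolding noncrossing_def by blast
    moreover have "T' = T" if nc: "noncrossing P T'" and sub: "T \<subseteq> T'" for T'
    proof -
      have "g \<in> T" if g: "g \<in> T'" for g
      proof -
        obtain i j where ij: "i < j" "j < n" "g = {f i, f j}"
          using nc g edges_on_iff unfolding noncrossing_def by (meson subsetD)
        have "{f i, f j} \<in> T"
        proof (rule maximal_nested_memI [OF M ij(1,2)])
          fix k l assume "k < l" "l < n" "{f k, f l} \<in> T" "interleaved i j k l"
          then show False
            using nc sub g ij crosses_iff unfolding noncrossing_def by blast
        qed
        then show ?thesis using ij by simp
      qed
      then show ?thesis using sub by blast
    qed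
    ultimately show ?L unfolding polygon_triangulation_def by blast
  qed
qed

end

section \<open>Flip distance through a fan\<close>

lemma relpowp_sym:
  assumes "symp R" "(R ^^ m) x y" shows "(R ^^ m) y x"
  using assms(2)
proof (induction m arbitrary: x)
  case (Suc m)
  then obtain z where "R x z" "(R ^^ m) z y" by (metis relpowp_Suc_D2)
  then show ?case using Suc.IH assms(1) by (meson relpowp_Suc_I sympD)
qed simp

lemma graph_dist_le_flips:
  assumes T: "polygon_triangulation P T" and walk: "(flip P ^^ m) T T'"
  shows "graph_dist (flip_graph P) T T' \<le> ereal m"
proof -
  interpret sym_digraph "flip_graph P" by (rule sym_digraph_flip_graph)
  have "\<exists>p. awalk T p T' \<and> length p = m" using T walk
  proof (induction m arbitrary: T)
    case 0
    then have "awalk T [] T'" by (simp add: awalk_Nil_iff) (simp add: flip_graph_def)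
    then show ?case by simp
  next
    case (Suc m)
    obtain S where S: "flip P T S" "(flip P ^^ m) S T'" using Suc.prems(2) by (metis relpowp_Suc_D2)
    then have "polygon_triangulation P S" by (simp add: flip_def)
    then obtain p where "awalk S p T'" "length p = m" using Suc.IH S by blast
    then have "awalk T ((T, S) # p) T' \<and> length ((T, S) # p) = Suc m"
      using S(1) by (simp add: awalk_Cons_iff) (simp add: flip_graph_def)
    then show ?case by blast
  qed
  then obtain p where p: "awalk T p T'" "length p = m" by blast
  have "awalk_cost (\<lambda>_. 1) p = m" using p(2) by (simp add: awalk_cost_def sum_list_triv)
  then show ?thesis unfolding graph_dist_def using min_cost_le_walk_cost [OF p(1), of "\<lambda>_. 1"] by simp
qed

context ccw_labelling
begin

lemma interior_degree_eq:
  assumes "T \<subseteq> edges_on P" "i < n"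
  shows "interior_degree P T (f i) = card {j. j < n \<and> {f i, f j} \<in> interior_edges P T}"
proof -
  have neq: "j \<noteq> i" if "{f i, f j} \<in> interior_edges P T" for j
    using that assms(1) by (auto simp: interior_edges_def edges_on_def)
  have "{e \<in> interior_edges P T. f i \<in> e} =
      (\<lambda>j. {f i, f j}) ` {j. j < n \<and> {f i, f j} \<in> interior_edges P T}" (is "?L = ?R")
  proof
    show "?L \<subseteq> ?R"
    proof
      fix e assume e: "e \<in> ?L"
      then have "e \<in> edges_on P" using assms(1) by (auto simp: interior_edges_def)
      then obtain k l where "k < l" "l < n" "e = {f k, f l}" using edges_on_iff by blast
      moreover from this have "i = k \<or> i = l"
        using e assms(2) label_eq_iff [of i k] label_eq_iff [of i l] by auto
      ultimately show "e \<in> ?R" using e by (auto simp: insert_commute)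
    qed
  qed auto
  moreover have "inj_on (\<lambda>j. {f i, f j}) {j. j < n \<and> {f i, f j} \<in> interior_edges P T}"
    using neq by (auto simp: inj_on_def doubleton_eq_iff label_eq_iff assms(2))
  ultimately show ?thesis unfolding interior_degree_def by (simp add: card_image)
qed

lemma interior_edge_iff:
  assumes "i < j" "j < n"
  shows "{f i, f j} \<in> interior_edges P T \<longleftrightarrow> {f i, f j} \<in> T \<and> j \<noteq> Suc i \<and> \<not> (i = 0 \<and> j = n - 1)"
  using boundary_iff [OF assms] by (auto simp: interior_edges_def)

lemma interior_degree_origin:
  assumes "T \<subseteq> edges_on P"
  shows "interior_degree P T (f 0) = card {j \<in> {2..<n - 1}. {f 0, f j} \<in> T}"
proof -
  have "{f 0, f 0} \<notin> interior_edges P T"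
    using assms by (auto simp: interior_edges_def edges_on_def)
  then have "{f 0, f j} \<in> interior_edges P T \<longleftrightarrow> j \<in> {2..<n - 1} \<and> {f 0, f j} \<in> T" if "j < n" for j
    using interior_edge_iff [of 0 j T] that by (cases "j = 0") auto
  then have "{j. j < n \<and> {f 0, f j} \<in> interior_edges P T} = {j \<in> {2..<n - 1}. {f 0, f j} \<in> T}"
    by auto
  then show ?thesis using interior_degree_eq [OF assms, of 0] three by simp
qed

lemma interior_degree_origin_le:
  assumes "T \<subseteq> edges_on P"
  shows "interior_degree P T (f 0) \<le> n - 3"
proof -
  have "card {j \<in> {2..<n - 1}. {f 0, f j} \<in> T} \<le> card {2..<n - 1}" by (rule card_mono) auto
  then show ?thesis using assms by (simp add: interior_degree_origin)
qed

text \<open>Around a missing spoke \<open>j\<close>, two consecutive neighbours \<open>a, b\<close> of the vertex labelled \<open>0\<close> are joined by a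
chord. Flipping it in the quadrilateral formed with the apex on its far side gives the vertex labelled
\<open>0\<close> one more neighbour.\<close>
lemma flip_towards_origin:
  assumes T: "polygon_triangulation P T" and j: "0 < j" "j < n" "{f 0, f j} \<notin> T"
  obtains T' where "flip P T T'"
    "interior_degree P T' (f 0) = Suc (interior_degree P T (f 0))"
proof -
  have TE: "T \<subseteq> edges_on P" and M: "maximal_nested n (\<lambda>i j. {f i, f j} \<in> T)"
    using T triangulation_iff by auto
  obtain a b where ab: "0 < a" "a < j" "j < b" "b < n" "{f 0, f a} \<in> T" "{f 0, f b} \<in> T"
    and gap: "\<And>i. a < i \<Longrightarrow> i < b \<Longrightarrow> {f 0, f i} \<notin> T"
    using maximal_nested_enclosing_gap [OF M j] by blast
  have abT: "{f a, f b} \<in> T" using maximal_nested_gap_chord [OF M] ab gap by auto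
  obtain c where c: "a < c" "c < b" "{f a, f c} \<in> T" "{f c, f b} \<in> T"
    using maximal_nested_apex [OF M _ _ abT] ab by auto
  define T' where "T' = insert {f 0, f c} (T - {{f a, f b}})"
  have mem: "{f k, f l} \<in> T' \<longleftrightarrow> k = 0 \<and> l = c \<or> {f k, f l} \<in> T \<and> \<not> (k = a \<and> l = b)"
    if "k < l" "l < n" for k l
    using that ab c by (simp add: T'_def pair_eq_iff)
  have "maximal_nested n (\<lambda>k l. {f k, f l} \<in> T') \<longleftrightarrow>
      maximal_nested n (\<lambda>k l. k = 0 \<and> l = c \<or> {f k, f l} \<in> T \<and> \<not> (k = a \<and> l = b))"
    by (rule maximal_nested_cong) (rule mem)
  then have "maximal_nested n (\<lambda>k l. {f k, f l} \<in> T')"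
    using maximal_nested_flip [OF M] ab abT c by auto
  moreover have T'E: "T' \<subseteq> edges_on P"
  proof -
    have "0 < c" "c < n" using ab c by auto
    then have "{f 0, f c} \<in> edges_on P" using edges_on_iff by blast
    then show ?thesis using TE by (auto simp: T'_def)
  qed
  ultimately have T': "polygon_triangulation P T'" by (simp add: triangulation_iff)
  have int: "{f a, f b} \<in> interior_edges P T" and neq: "{f 0, f c} \<noteq> {f a, f b}"
    using ab c abT by (auto simp: interior_edge_iff pair_eq_iff)
  have "flip P T T'"
    unfolding flip_def
    by (intro conjI T T' bexI [OF _ int] exI [of _ "{f 0, f c}"] neq) (fact T'_def)
  moreover have "{i \<in> {2..<n - 1}. {f 0, f i} \<in> T'} = insert c {i \<in> {2..<n - 1}. {f 0, f i} \<in> T}"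
    using mem [of 0] ab c by auto
  moreover have "{f 0, f c} \<notin> T" using gap c by blast
  ultimately show thesis
    using that by (simp add: interior_degree_origin TE T'E)
qed

definition origin_fan :: "(real^2) set set" where
  "origin_fan = {e \<in> edges_on P. f 0 \<in> e} \<union> boundary_edges P"

lemma triangulation_eq_origin_fan:
  assumes T: "polygon_triangulation P T" and all: "\<And>j. 0 < j \<Longrightarrow> j < n \<Longrightarrow> {f 0, f j} \<in> T"
  shows "T = origin_fan"
proof -
  have TE: "T \<subseteq> edges_on P" and M: "maximal_nested n (\<lambda>i j. {f i, f j} \<in> T)"
    using T triangulation_iff by auto
  have "e \<in> T \<longleftrightarrow> e \<in> origin_fan" if "e \<in> edges_on P" for e
  proof -
    from that obtain i j where ij: "i < j" "j < n" "e = {f i, f j}"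
      unfolding edges_on_iff by blast
    have "f 0 \<in> e \<longleftrightarrow> i = 0" using ij by (auto simp: label_eq_iff)
    then show ?thesis
      using maximal_nested_eq_fan [OF M all ij(1,2)] that boundary_iff [OF ij(1,2)] ij(3)
      by (auto simp: origin_fan_def)
  qed
  moreover have "origin_fan \<subseteq> edges_on P" by (auto simp: origin_fan_def boundary_edges_def)
  ultimately show ?thesis using TE by blast
qed

text \<open>Every flip of the previous kind raises the degree of the vertex labelled \<open>0\<close> by one, from its initial
value to at most \<open>n - 3\<close>.\<close>
lemma flips_to_origin_fan:
  assumes "polygon_triangulation P T"
  obtains m where "m + interior_degree P T (f 0) \<le> n - 3" "(flip P ^^ m) T origin_fan"
proof -
  have "\<exists>m. m + interior_degree P T (f 0) \<le> n - 3 \<and> (flip P ^^ m) T origin_fan"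
    using assms
  proof (induction "n - 3 - interior_degree P T (f 0)" arbitrary: T rule: less_induct)
    case less
    have deg: "interior_degree P S (f 0) \<le> n - 3" if "polygon_triangulation P S" for S
      using that interior_degree_origin_le triangulation_iff by blast
    show ?case
    proof (cases "\<exists>j. 0 < j \<and> j < n \<and> {f 0, f j} \<notin> T")
      case True
      then obtain S where S: "flip P T S"
        "interior_degree P S (f 0) = Suc (interior_degree P T (f 0))"
        using flip_towards_origin [OF less.prems] by metis
      then have S': "polygon_triangulation P S" by (simp add: flip_def)
      have "n - 3 - interior_degree P S (f 0) < n - 3 - interior_degree P T (f 0)"
        using S(2) deg [OF S'] by linarith
      from less.hyps [OF this S']
      obtain m where "m + interior_degree P S (f 0) \<le> n - 3" "(flip P ^^ m) S origin_fan"
        by blast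
      then show ?thesis
        using S(2) relpowp_Suc_I2 [of "flip P" T S m, OF S(1)] by (intro exI [of _ "Suc m"]) auto
    next
      case False
      then have "T = origin_fan" using triangulation_eq_origin_fan less.prems by blast
      then show ?thesis using deg [OF less.prems] by (intro exI [of _ 0]) auto
    qed
  qed
  then show thesis using that by blast
qed

lemma graph_dist_le_via_origin_fan:
  assumes T: "polygon_triangulation P T" and S: "polygon_triangulation P S"
  shows "graph_dist (flip_graph P) T S
    \<le> ereal (2 * real n - 6 - real (interior_degree P T (f 0)) - real (interior_degree P S (f 0)))"
proof -
  obtain m where m: "m + interior_degree P T (f 0) \<le> n - 3" "(flip P ^^ m) T origin_fan"
    using flips_to_origin_fan [OF T] .
  obtain l where l: "l + interior_degree P S (f 0) \<le> n - 3" "(flip P ^^ l) S origin_fan"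
    using flips_to_origin_fan [OF S] .
  have "symp (flip P)" by (simp add: symp_def flip_sym)
  then have "(flip P ^^ (m + l)) T S"
    using m(2) relpowp_sym [OF _ l(2)] by (auto simp: relpowp_add)
  then have "graph_dist (flip_graph P) T S \<le> ereal (real (m + l))"
    by (rule graph_dist_le_flips [OF T])
  also have "\<dots> \<le> ereal (2 * real n - 6 - real (interior_degree P T (f 0)) - real (interior_degree P S (f 0)))"
    using m(1) l(1) three by simp
  finally show ?thesis .
qed

text \<open>If the vertex labelled \<open>0\<close> is incident to no interior edge, its two neighbours on the boundary are
joined, and this is an interior edge at the vertex labelled \<open>1\<close>.\<close>
lemma interior_degree_next_pos:
  assumes T: "polygon_triangulation P T" and "4 \<le> n" and 0: "interior_degree P T (f 0) = 0"
  shows "0 < interior_degree P T (f 1)"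
proof -
  have TE: "T \<subseteq> edges_on P" and M: "maximal_nested n (\<lambda>i j. {f i, f j} \<in> T)"
    using T triangulation_iff by auto
  have "{f 0, f i} \<notin> T" if "1 < i" "i < n - 1" for i
    using 0 that by (auto simp: interior_degree_origin [OF TE])
  moreover have "{f 0, f 1} \<in> T" "{f 0, f (n - 1)} \<in> T"
    using maximal_nested_side [OF M, of 0] maximal_nested_long_side [OF M] \<open>4 \<le> n\<close> by auto
  ultimately have "{f 1, f (n - 1)} \<in> T"
    using maximal_nested_gap_chord [OF M, of 1 "n - 1"] \<open>4 \<le> n\<close> by auto
  then have "n - 1 \<in> {j. j < n \<and> {f 1, f j} \<in> interior_edges P T}"
    using \<open>4 \<le> n\<close> interior_edge_iff [of 1 "n - 1" T] by auto
  then show ?thesis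
    using \<open>4 \<le> n\<close> interior_degree_eq [OF TE, of 1] card_gt_0_iff by fastforce
qed

section \<open>The triangulation with two adjacent fans\<close>

definition double_fan_triangulation :: "nat \<Rightarrow> (real^2) set set" where
  "double_fan_triangulation d = {{f i, f j} | i j. i < j \<and> j < n \<and> double_fan n d i j}"

lemma double_fan_triangulation_iff:
  "i < j \<Longrightarrow> j < n \<Longrightarrow> {f i, f j} \<in> double_fan_triangulation d \<longleftrightarrow> double_fan n d i j"
  unfolding double_fan_triangulation_def mem_Collect_eq using pair_eq_iff by blast

context
  fixes d :: nat
  assumes d: "2 \<le> d" and n: "2 * d + 3 \<le> n"
begin

lemma triangulation_double_fan: "polygon_triangulation P (double_fan_triangulation d)"
proof -
  have "maximal_nested n (\<lambda>i j. {f i, f j} \<in> double_fan_triangulation d)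
      \<longleftrightarrow> maximal_nested n (double_fan n d)"
    by (rule maximal_nested_cong) (rule double_fan_triangulation_iff)
  moreover have "double_fan_triangulation d \<subseteq> edges_on P"
    unfolding double_fan_triangulation_def using edges_on_iff by blast
  ultimately show ?thesis using maximal_nested_double_fan [of d n] d n by (simp add: triangulation_iff)
qed

lemma double_fan_neighbours:
  assumes "i < n"
  shows "{j. j < n \<and> {f i, f j} \<in> interior_edges P (double_fan_triangulation d)} =
    {j. j < n \<and> (i < j \<and> double_fan n d i j \<and> j \<noteq> Suc i \<and> \<not> (i = 0 \<and> j = n - 1) \<or>
                j < i \<and> double_fan n d j i \<and> i \<noteq> Suc j \<and> \<not> (j = 0 \<and> i = n - 1))}"
proof -
  have "{f i, f i} \<notin> double_fan_triangulation d"
    using triangulation_double_fan by (auto simp: triangulation_iff edges_on_def)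
  then have "{f i, f j} \<in> interior_edges P (double_fan_triangulation d) \<longleftrightarrow>
      i < j \<and> double_fan n d i j \<and> j \<noteq> Suc i \<and> \<not> (i = 0 \<and> j = n - 1) \<or>
      j < i \<and> double_fan n d j i \<and> i \<noteq> Suc j \<and> \<not> (j = 0 \<and> i = n - 1)" if "j < n" for j
    using interior_edge_iff [of i j] interior_edge_iff [of j i]
      double_fan_triangulation_iff [of i j] double_fan_triangulation_iff [of j i] assms that
    by (cases i j rule: linorder_cases) (auto simp: insert_commute interior_edges_def)
  then show ?thesis by auto
qed

lemma double_fan_degree:
  assumes "i < n"
  shows "interior_degree P (double_fan_triangulation d) (f i) = card
    {j. j < n \<and> (i < j \<and> double_fan n d i j \<and> j \<noteq> Suc i \<and> \<not> (i = 0 \<and> j = n - 1) \<or>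
                j < i \<and> double_fan n d j i \<and> i \<noteq> Suc j \<and> \<not> (j = 0 \<and> i = n - 1))}"
    (is "_ = card ?N")
  using triangulation_double_fan interior_degree_eq [OF _ assms] double_fan_neighbours [OF assms]
  by (simp add: triangulation_iff)

lemma double_fan_degree_0: "interior_degree P (double_fan_triangulation d) (f 0) = d"
proof -
  have "{j. j < n \<and> (0 < j \<and> double_fan n d 0 j \<and> j \<noteq> Suc 0 \<and> \<not> (0 = (0::nat) \<and> j = n - 1) \<or>
      j < 0 \<and> double_fan n d j 0 \<and> 0 \<noteq> Suc j \<and> \<not> (j = 0 \<and> 0 = n - 1))} = {d + 2..2 * d + 1}"
    using d n by (auto simp: double_fan_def)
  then show ?thesis using double_fan_degree [of 0] n by simp
qed

lemma double_fan_degree_1: "interior_degree P (double_fan_triangulation d) (f 1) = d"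
proof -
  have "{j. j < n \<and> (1 < j \<and> double_fan n d 1 j \<and> j \<noteq> Suc 1 \<and> \<not> (1 = (0::nat) \<and> j = n - 1) \<or>
      j < 1 \<and> double_fan n d j 1 \<and> 1 \<noteq> Suc j \<and> \<not> (j = 0 \<and> 1 = n - 1))} = {3..d + 2}"
    using d n by (auto simp: double_fan_def)
  then show ?thesis using double_fan_degree [of 1] n by simp
qed

text \<open>A vertex in the range of the fans is on at most one spoke of each fan. The vertex \<open>2 * d + 1\<close> is on
at most the last spoke at \<open>0\<close> and the base of the zigzag, and a vertex beyond it is on at most the two
zigzag steps given by the two index sums.\<close>
lemma double_fan_degree_le:
  assumes i: "2 \<le> i" "i < n"
  shows "interior_degree P (double_fan_triangulation d) (f i) \<le> 2"
proof -
  let ?N = "{j. j < n \<and> (i < j \<and> double_fan n d i j \<and> j \<noteq> Suc i \<and> \<not> (i = 0 \<and> j = n - 1) \<or>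
      j < i \<and> double_fan n d j i \<and> i \<noteq> Suc j \<and> \<not> (j = 0 \<and> i = n - 1))}"
  obtain x y where "?N \<subseteq> {x, y}"
  proof -
    consider "i \<le> 2 * d" | "i = 2 * d + 1" | "2 * d + 1 < i" by linarith
    then show thesis
    proof cases
      case 1
      then have "?N \<subseteq> {0, 1}" using i d n by (auto simp: double_fan_def)
      then show thesis by (rule that)
    next
      case 2
      then have "?N \<subseteq> {0, n - 1}" using i d n by (auto simp: double_fan_def)
      then show thesis by (rule that)
    next
      case 3
      then have "?N \<subseteq> {n + 2 * d - i, n + 2 * d + 1 - i}" using i d n by (auto simp: double_fan_def)
      then show thesis by (rule that)
    qed
  qed
  then have "card ?N \<le> card {x, y}" by (intro card_mono) auto
  also have "\<dots> \<le> 2" by (simp add: card_insert_if)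
  finally show ?thesis using double_fan_degree [OF i(2)] by simp
qed

lemma max_interior_degree_double_fan: "max_interior_degree P (double_fan_triangulation d) = d"
proof -
  have "interior_degree P (double_fan_triangulation d) v \<le> d" if "v \<in> polygon_vertices P" for v
  proof -
    from that obtain i where "i < n" "v = f i" by (rule vertex_cases)
    then show ?thesis
      using double_fan_degree_0 double_fan_degree_1 double_fan_degree_le [of i] d
      by (cases "i = 0 \<or> i = 1") auto
  qed
  moreover have "d \<in> interior_degree P (double_fan_triangulation d) ` polygon_vertices P"
    using double_fan_degree_0 vertex [of 0] n by (force intro: image_eqI)
  moreover have "finite (polygon_vertices P)" using polytope_eq_hull_vertices [OF polytope] by simp
  ultimately show ?thesis unfolding max_interior_degree_def by (intro Max_eqI) auto
qed

text \<open>The route through the fan at the vertex labelled \<open>0\<close> or at the one labelled \<open>1\<close> saves the degree \<open>d\<close>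
on the way up. One of these two vertices has positive degree in the target, which saves another flip
on the way down.\<close>
lemma eccentricity_double_fan:
  "eccentricity (flip_graph P) (double_fan_triangulation d) \<le> ereal (2 * real n - 7 - real d)"
  unfolding eccentricity_def
proof (rule SUP_least)
  fix S assume "S \<in> verts (flip_graph P)"
  then have S: "polygon_triangulation P S" by (simp add: flip_graph_def)
  interpret shifted: ccw_labelling P "\<lambda>i. f (Suc i mod n)" n by (rule rotated)
  \<comment> \<open>Either centre has degree \<open>d\<close> in the double fan; \<open>m\<close> is its degree in \<open>S\<close>.\<close>
  have bound: "graph_dist (flip_graph P) (double_fan_triangulation d) S \<le> ereal (2 * real n - 7 - real d)"
    if "graph_dist (flip_graph P) (double_fan_triangulation d) S \<le> ereal (2 * real n - 6 - real d - real m)"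
      "0 < m" for m
    by (rule order_trans [OF that(1)]) (use that(2) in simp)
  show "graph_dist (flip_graph P) (double_fan_triangulation d) S \<le> ereal (2 * real n - 7 - real d)"
  proof (cases "interior_degree P S (f 0) = 0")
    case True
    then have "0 < interior_degree P S (f 1)" using interior_degree_next_pos [OF S] d n by simp
    moreover have "Suc 0 mod n = 1" using n by simp
    ultimately show ?thesis
      using shifted.graph_dist_le_via_origin_fan [OF triangulation_double_fan S] double_fan_degree_1
      by (intro bound [of "interior_degree P S (f 1)"]) auto
  next
    case False
    then show ?thesis
      using graph_dist_le_via_origin_fan [OF triangulation_double_fan S] double_fan_degree_0
      by (intro bound [of "interior_degree P S (f 0)"]) auto
  qed
qed

end

end

theorem theorem5p1:
  fixes P :: "(real^2) set" and n :: nat and k :: int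
  assumes "convex_polygon P"
    and "card (polygon_vertices P) = n"
    and "real n / 2 - 2 < real_of_int k"
    and "k \<le> int n - 5"
  shows "\<exists>T. polygon_triangulation P T \<and>
             int (max_interior_degree P T) = int n - 3 - k \<and>
             eccentricity (flip_graph P) T \<le> ereal (real_of_int (int n - 4 + k))"
proof -
  define d where "d = nat (int n - 3 - k)"
  have dk: "int d = int n - 3 - k" using assms(4) by (simp add: d_def)
  then have "real d = real n - 3 - real_of_int k" by linarith
  then have "2 * real d < real n - 2" using assms(3) by linarith
  then have d: "2 \<le> d" "2 * d + 3 \<le> n" using assms(4) dk by linarith+
  have "polytope P" using assms(1) by (simp add: convex_polygon_def)
  moreover have "3 \<le> n" using d by simp
  ultimately obtain f where "ccw_labelling P f n" by (rule ccw_labelling_exists [OF _ assms(2)])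
  then interpret ccw_labelling P f n .
  have "2 * real n - 7 - real d = real_of_int (int n - 4 + k)" using dk by linarith
  then have "eccentricity (flip_graph P) (double_fan_triangulation d)
      \<le> ereal (real_of_int (int n - 4 + k))"
    using eccentricity_double_fan [OF d] by (simp only:)
  then show ?thesis
    using triangulation_double_fan [OF d] max_interior_degree_double_fan [OF d] dk
    by (intro exI conjI) simp_all
qed

end
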